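(* Let $\mathrm{w}=(w_k)_{k\ge 0}$ be any sequence of non-negative real weights with $w_0>0$, and let $n\ge 3$ be any integer for which $Z_n(\mathrm{w})>0$. Let $T_{\mathrm{w},n}$ be the simply generated tree of size $n$ with weight sequence $\mathrm{w}$. Then for all $s>0$, \[\mathbb{P}\big(\mathrm{Wd}(T_{\mathrm{w},n})\,\mathrm{Ht}(T_{\mathrm{w},n})>s\,n\log n\big)\le 230\,s^{-2/13}.\]
   Context: For a finite rooted tree $t$: the size $\#t$ is its number of vertices; the height $\mathrm{Ht}(t)$ is the maximum graph distance of a vertex of $t$ to the root; the width $\mathrm{Wd}(t)$ is the maximum over $h\ge 0$ of the number of vertices at distance exactly $h$ from the root. A plane tree is a finite rooted tree in which the children of every vertex are linearly ordered; $\mathrm{k}_v(t)$ is the number of children of $v$ in $t$. The weight of a finite plane tree $t$ is $\mathrm{w}(t)=\prod_{v\in t}w_{\mathrm{k}_v(t)}$, and $Z_n(\mathrm{w})=\sum_{t}\mathrm{w}(t)$, where the sum is over all plane trees $t$ with $\#t=n$. If $Z_n(\mathrm{w})>0$, the simply generated tree $T_{\mathrm{w},n}$ is the random plane tree of size $n$ with $\mathbb{P}(T_{\mathrm{w},n}=t)=\mathrm{w}(t)/Z_n(\mathrm{w})$ for all plane trees $t$ with $\#t=n$. $\log$ is the natural logarithm. *)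

theory Defs
  imports "HOL-Probability.Probability"
begin

text \<open>
  A (finite) plane tree is a root together with the ordered list of the subtrees rooted at its
  children. Since children are ordered, plane trees have no nontrivial automorphisms, and the
  elements of this type are exactly the isomorphism classes of plane trees.
\<close>

datatype plane_tree = PNode "plane_tree list"

text \<open>
  Ulam--Harris addresses: a vertex is identified with the path leading to it from the root,
  recorded as the list of (zero-based) birth ranks along the way. The root is \<open>[]\<close>, the children
  of \<open>v\<close> are the vertices of the form \<open>v @ [i]\<close>, and the graph distance of \<open>v\<close> to the root is
  \<open>length v\<close>.
\<close>

function vertices :: "plane_tree \<Rightarrow> nat list set" where
  "vertices (PNode ts) = insert [] (\<Union>i\<in>{..<length ts}. (#) i ` vertices (ts ! i))"
  by pat_completeness auto
termination
  by (relation "Wellfounded.measure size") (auto simp: less_Suc_eq_le intro!: size_list_estimation' [OF nth_mem])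

definition num_children :: "plane_tree \<Rightarrow> nat list \<Rightarrow> nat" where
  "num_children t v = card {i. v @ [i] \<in> vertices t}"

definition tree_size :: "plane_tree \<Rightarrow> nat" where
  "tree_size t = card (vertices t)"

definition tree_height :: "plane_tree \<Rightarrow> nat" where
  "tree_height t = Max (length ` vertices t)"

text \<open>The maximum is over all \<open>h \<ge> 0\<close>; it exists because the counts are at most the size.\<close>

definition tree_width :: "plane_tree \<Rightarrow> nat" where
  "tree_width t = Max (range (\<lambda>h. card {v \<in> vertices t. length v = h}))"

definition tree_weight :: "(nat \<Rightarrow> real) \<Rightarrow> plane_tree \<Rightarrow> real" where
  "tree_weight w t = (\<Prod>v\<in>vertices t. w (num_children t v))"

definition partition_function :: "(nat \<Rightarrow> real) \<Rightarrow> nat \<Rightarrow> real" where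
  "partition_function w n = (\<Sum>t\<in>{t. tree_size t = n}. tree_weight w t)"

text \<open>
  The law of the simply generated tree. It is only meaningful if the weights are nonnegative and
  the partition function is positive; see \<open>pmf_simply_generated_tree\<close> below.
\<close>

definition simply_generated_tree :: "(nat \<Rightarrow> real) \<Rightarrow> nat \<Rightarrow> plane_tree pmf" where
  "simply_generated_tree w n =
     embed_pmf (\<lambda>t. if tree_size t = n then tree_weight w t / partition_function w n else 0)"

lemma finite_vertices [simp]: "finite (vertices t)"
  by (induction t rule: vertices.induct) auto

lemma vertices_nonempty [simp]: "vertices t \<noteq> {}"
  by (cases t) auto

lemma finite_level_counts: "finite (range (\<lambda>h. card {v \<in> vertices t. length v = h}))"
proof (rule finite_subset)
  show "range (\<lambda>h. card {v \<in> vertices t. length v = h}) \<subseteq> {..tree_size t}"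
    unfolding tree_size_def by (auto intro!: card_mono)
qed simp

lemma tree_size_Node: "tree_size (PNode ts) = Suc (\<Sum>i<length ts. tree_size (ts ! i))"
proof -
  let ?U = "\<Union>i\<in>{..<length ts}. (#) i ` vertices (ts ! i)"
  have "card ?U = (\<Sum>i<length ts. card ((#) i ` vertices (ts ! i)))"
    by (rule card_UN_disjoint) auto
  also have "\<dots> = (\<Sum>i<length ts. tree_size (ts ! i))"
    unfolding tree_size_def by (intro sum.cong card_image refl) (auto simp: inj_on_def)
  finally have "card ?U = (\<Sum>i<length ts. tree_size (ts ! i))" .
  moreover have "[] \<notin> ?U" by auto
  ultimately show ?thesis by (simp add: tree_size_def card_insert_if del: UN_simps)
qed

lemma tree_size_pos: "tree_size t > 0"
  by (cases t) (simp add: tree_size_Node)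

lemma finite_trees_size_le: "finite {t. tree_size t \<le> n}"
proof (induction n)
  case 0
  then show ?case by (simp add: tree_size_pos[THEN less_imp_neq, symmetric])
next
  case (Suc n)
  let ?A = "{t. tree_size t \<le> n}"
  have "{t. tree_size t \<le> Suc n} \<subseteq> PNode ` {ts. set ts \<subseteq> ?A \<and> length ts \<le> n}"
  proof
    fix t assume t: "t \<in> {t. tree_size t \<le> Suc n}"
    obtain ts where ts: "t = PNode ts" by (cases t)
    have le: "(\<Sum>i<length ts. tree_size (ts ! i)) \<le> n"
      using t by (simp add: ts tree_size_Node)
    have "length ts = (\<Sum>i<length ts. 1)" by simp
    also have "\<dots> \<le> (\<Sum>i<length ts. tree_size (ts ! i))"
      by (intro sum_mono) (simp add: Suc_leI tree_size_pos)
    finally have "length ts \<le> n" using le by simp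
    moreover have "tree_size (ts ! i) \<le> n" if "i < length ts" for i
      using member_le_sum[of i "{..<length ts}" "\<lambda>i. tree_size (ts ! i)"] that le by simp
    ultimately show "t \<in> PNode ` {ts. set ts \<subseteq> ?A \<and> length ts \<le> n}"
      unfolding ts by (intro imageI) (auto simp: in_set_conv_nth)
  qed
  moreover have "finite (PNode ` {ts. set ts \<subseteq> ?A \<and> length ts \<le> n})"
    using finite_lists_length_le[OF Suc.IH] by simp
  ultimately show ?case by (rule finite_subset)
qed

lemma finite_trees_of_size: "finite {t. tree_size t = n}"
  by (rule finite_subset[OF _ finite_trees_size_le[of n]]) auto

lemma tree_weight_nonneg: "(\<And>k. w k \<ge> 0) \<Longrightarrow> tree_weight w t \<ge> 0"
  by (simp add: tree_weight_def prod_nonneg)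

lemma pmf_simply_generated_tree:
  assumes "\<And>k. w k \<ge> 0" and Z: "partition_function w n > 0"
  shows "pmf (simply_generated_tree w n) t =
    (if tree_size t = n then tree_weight w t / partition_function w n else 0)"
  unfolding simply_generated_tree_def
proof (rule pmf_embed_pmf)
  let ?f = "\<lambda>t. if tree_size t = n then tree_weight w t / partition_function w n else 0"
  let ?A = "{t. tree_size t = n}"
  show nonneg: "0 \<le> ?f t" for t
    using Z tree_weight_nonneg[of w, OF assms(1)] by simp
  have "(\<integral>\<^sup>+ t. ennreal (?f t) \<partial>count_space UNIV) = (\<Sum>t\<in>?A. ennreal (?f t))"
    by (rule nn_integral_count_space'[OF finite_trees_of_size]) auto
  also have "\<dots> = ennreal (\<Sum>t\<in>?A. ?f t)"
    by (rule sum_ennreal) (rule nonneg)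
  also have "(\<Sum>t\<in>?A. ?f t) = (\<Sum>t\<in>?A. tree_weight w t) / partition_function w n"
    by (simp add: sum_divide_distrib)
  also have "\<dots> = 1" using Z by (simp add: partition_function_def)
  finally show "(\<integral>\<^sup>+ t. ennreal (?f t) \<partial>count_space UNIV) = 1" by simp
qed

end

theory Submission
  imports Defs "HOL-Combinatorics.Multiset_Permutations" "HOL-Computational_Algebra.Polynomial"
begin

text \<open>
  Conditionally on the multiset \<open>D\<close> of its vertex degrees, the simply generated tree is uniform on the
  trees with degree multiset \<open>D\<close>, so it suffices to bound the proportion of bad trees for each \<open>D\<close>.
  Let \<open>\<sigma>\<^sup>2 = \<Sum>k\<in>#D. (k - 1)\<^sup>2\<close>.

  Height: deleting the path to a vertex at height \<open>h\<close> bounds the mean size of level \<open>h\<close> by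
  \<open>n / (n choose h)\<close> times the \<open>h\<close>-th elementary symmetric polynomial of the degrees. A saddle point
  bound for the latter gives \<open>P(Ht \<ge> h) \<le> n (n + 1) exp (- h \<sigma> / (4 n))\<close> as soon as \<open>h \<sigma> \<ge> n\<close>; hence
  the height exceeds \<open>12 (n / \<sigma>) ln n\<close> with probability at most \<open>2 / n\<close>.

  Width: the level sizes are values of the breadth-first queue, an excursion of which a uniformly
  chosen cyclic shift is a uniform permutation of \<open>D\<close>. A maximal inequality for exchangeable bridges then gives
  \<open>P(Wd > K) \<le> 4 (1 + \<sigma>\<^sup>2) / K\<^sup>2\<close>.

  Together these give the tail \<open>23 / s\<close> for \<open>s \<ge> 230\<close>; for smaller \<open>s\<close> the claimed bound exceeds 1.
\<close>

section \<open>Forests and their degree multisets\<close>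

fun subtrees :: "plane_tree \<Rightarrow> plane_tree list" where
  "subtrees (PNode ts) = ts"

fun degs :: "plane_tree \<Rightarrow> nat multiset" where
  "degs (PNode ts) = add_mset (length ts) (\<Sum>t\<leftarrow>ts. degs t)"

definition forest_degs :: "plane_tree list \<Rightarrow> nat multiset" where
  "forest_degs F = (\<Sum>t\<leftarrow>F. degs t)"

lemma forest_degs_simps [simp]:
  "forest_degs [] = {#}"
  "forest_degs (t # F) = degs t + forest_degs F"
  "forest_degs (F @ G) = forest_degs F + forest_degs G"
  by (simp_all add: forest_degs_def)

lemma degs_PNode: "degs (PNode ts) = add_mset (length ts) (forest_degs ts)"
  by (simp add: forest_degs_def)

declare degs.simps [simp del]
declare degs_PNode [simp]

lemma forest_degs_rotate [simp]: "forest_degs (rotate i F) = forest_degs F"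
proof -
  have "forest_degs (rotate i F)
      = forest_degs (take (i mod length F) F @ drop (i mod length F) F)"
    unfolding rotate_drop_take forest_degs_simps(3) by (rule add.commute)
  then show ?thesis by simp
qed

lemma degs_not_empty [simp]: "degs t \<noteq> {#}"
  by (cases t) simp

lemma forest_degs_eq_empty_iff [simp]: "forest_degs F = {#} \<longleftrightarrow> F = []"
  by (cases F) auto

lemma sum_list_nth: "sum_list (map f xs) = (\<Sum>i<length xs. f (xs ! i))"
  by (simp add: sum_list_sum_nth atLeast0LessThan)

lemma size_degs: "size (degs t) = tree_size t"
proof (induction t)
  case (PNode ts)
  have "size (forest_degs ts) = (\<Sum>t\<leftarrow>ts. tree_size t)"
    using PNode by (induction ts) auto
  then show ?case
    by (simp add: tree_size_Node sum_list_nth)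
qed

text \<open>Every vertex is either a root or a child of exactly one vertex. The induction deletes
  the first root and puts its children in its place.\<close>

lemma size_forest_degs: "size (forest_degs F) = length F + (\<Sum>k\<in>#forest_degs F. k)"
proof (induction "size (forest_degs F)" arbitrary: F rule: less_induct)
  case less
  show ?case
  proof (cases F)
    case (Cons t G)
    obtain ts where t: "t = PNode ts" by (cases t)
    have "size (forest_degs (ts @ G)) = length (ts @ G) + (\<Sum>k\<in>#forest_degs (ts @ G). k)"
      by (rule less) (simp add: Cons t)
    then show ?thesis by (simp add: Cons t)
  qed simp
qed

section \<open>Vertices, levels and weights\<close>

lemma vertices_PNode_Cons:
  "i # v \<in> vertices (PNode ts) \<longleftrightarrow> i < length ts \<and> v \<in> vertices (ts ! i)"
  by auto

lemma Nil_in_vertices [simp]: "[] \<in> vertices t"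
  by (cases t) simp

lemma num_children_Nil [simp]: "num_children (PNode ts) [] = length ts"
  by (simp add: num_children_def vertices_PNode_Cons del: vertices.simps)

lemma num_children_Cons [simp]:
  "i < length ts \<Longrightarrow> num_children (PNode ts) (i # v) = num_children (ts ! i) v"
  by (simp add: num_children_def vertices_PNode_Cons del: vertices.simps)

lemma tree_weight_PNode:
  "tree_weight w (PNode ts) = w (length ts) * (\<Prod>i<length ts. tree_weight w (ts ! i))"
proof -
  let ?U = "\<lambda>i. (#) i ` vertices (ts ! i)"
  let ?g = "\<lambda>v. w (num_children (PNode ts) v)"
  have "tree_weight w (PNode ts) = ?g [] * prod ?g (\<Union>i\<in>{..<length ts}. ?U i)"
    unfolding tree_weight_def vertices.simps by (subst prod.insert) auto
  also have "prod ?g (\<Union>i\<in>{..<length ts}. ?U i) = (\<Prod>i<length ts. prod ?g (?U i))"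
    by (rule prod.UNION_disjoint) auto
  also have "\<dots> = (\<Prod>i<length ts. tree_weight w (ts ! i))"
    by (intro prod.cong refl) (simp add: tree_weight_def prod.reindex)
  finally show ?thesis by simp
qed

text \<open>This is why conditioning on the degree multiset gives a uniform tree: the weight is
  constant on each class.\<close>

lemma tree_weight_degs: "tree_weight w t = (\<Prod>k\<in>#degs t. w k)"
proof (induction t)
  case (PNode ts)
  have "(\<Prod>k\<in>#forest_degs ts. w k) = (\<Prod>t\<leftarrow>ts. tree_weight w t)"
    using PNode by (induction ts) auto
  then show ?case
    by (simp add: tree_weight_PNode prod.list_conv_set_nth atLeast0LessThan)
qed

lemma take_in_vertices: "v \<in> vertices t \<Longrightarrow> take h v \<in> vertices t"
proof (induction t arbitrary: v h)
  case (PNode ts)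
  then show ?case
    by (cases v; cases h) (auto simp: vertices_PNode_Cons simp del: vertices.simps)
qed

lemma length_less_tree_size: "v \<in> vertices t \<Longrightarrow> length v < tree_size t"
proof (induction t arbitrary: v)
  case (PNode ts)
  show ?case
  proof (cases v)
    case Nil
    then show ?thesis by (simp add: tree_size_pos)
  next
    case (Cons i u)
    then have i: "i < length ts" "u \<in> vertices (ts ! i)"
      using PNode.prems by (auto simp: vertices_PNode_Cons simp del: vertices.simps)
    then have "length u < tree_size (ts ! i)"
      by (intro PNode.IH) auto
    also have "\<dots> \<le> (\<Sum>i<length ts. tree_size (ts ! i))"
      using i by (intro member_le_sum) auto
    finally show ?thesis by (simp add: Cons tree_size_Node)
  qed
qed

lemma tree_height_less: "tree_height t < tree_size t"
  unfolding tree_height_def by (subst Max_less_iff) (auto intro: length_less_tree_size)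

text \<open>The entries are the subtrees rooted at level \<open>h\<close>, so the length of the list
  is the size of that level.\<close>

fun generation :: "nat \<Rightarrow> plane_tree list \<Rightarrow> plane_tree list" where
  "generation 0 F = F"
| "generation (Suc h) F = generation h (concat (map subtrees F))"

lemma generation_append: "generation h (F @ G) = generation h F @ generation h G"
  by (induction h arbitrary: F G) auto

lemma generation_Nil [simp]: "generation h [] = []"
  by (induction h) auto

lemma length_generation: "length (generation h F) = (\<Sum>t\<leftarrow>F. length (generation h [t]))"
proof (induction F)
  case (Cons t F)
  show ?case
    using Cons generation_append[of h "[t]" F] by simp
qed simp

lemma card_level: "card {v \<in> vertices t. length v = h} = length (generation h [t])"
proof (induction h arbitrary: t)
  case 0
  have "{v \<in> vertices t. length v = 0} = {[]}" by auto
  then show ?case by simp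
next
  case (Suc h)
  obtain ts where t: "t = PNode ts" by (cases t)
  let ?L = "\<lambda>i. {v \<in> vertices (ts ! i). length v = h}"
  have "{v \<in> vertices t. length v = Suc h} = (\<Union>i\<in>{..<length ts}. (#) i ` ?L i)"
    unfolding t by auto
  also have "card \<dots> = (\<Sum>i<length ts. card ((#) i ` ?L i))"
    by (rule card_UN_disjoint) auto
  also have "\<dots> = (\<Sum>i<length ts. length (generation h [ts ! i]))"
    by (simp add: card_image Suc.IH)
  also have "\<dots> = length (generation h ts)"
    by (subst length_generation) (simp add: sum_list_nth)
  finally show ?case by (simp add: t)
qed

lemma tree_width_attained: "\<exists>h. tree_width t = length (generation h [t])"
  using Max_in[OF finite_level_counts[of t]] by (auto simp: tree_width_def card_level)

lemma tree_width_le: "tree_width t \<le> tree_size t"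
proof -
  obtain h where "tree_width t = card {v \<in> vertices t. length v = h}"
    using tree_width_attained card_level by metis
  also have "\<dots> \<le> tree_size t"
    unfolding tree_size_def by (intro card_mono) auto
  finally show ?thesis .
qed

text \<open>Truncating the address of a highest vertex gives a vertex on any lower level.\<close>

lemma generation_nonempty:
  assumes "h \<le> tree_height t"
  shows "generation h [t] \<noteq> []"
proof -
  have "tree_height t \<in> length ` vertices t"
    unfolding tree_height_def by (rule Max_in) auto
  then obtain v where "v \<in> vertices t" "length v = tree_height t" by auto
  with assms have "take h v \<in> {v \<in> vertices t. length v = h}"
    by (auto simp: take_in_vertices)
  then have "card {v \<in> vertices t. length v = h} \<noteq> 0"
    by (metis (no_types, lifting) card_eq_0_iff empty_iff finite_vertices rev_finite_subset mem_Collect_eq subsetI)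
  then show ?thesis by (auto simp: card_level)
qed

section \<open>Breadth-first words\<close>

text \<open>The argument is the queue of a breadth-first search; the result is the Lukasiewicz word
  of the forest in breadth-first order.\<close>

function bfs :: "plane_tree list \<Rightarrow> nat list" where
  "bfs [] = []"
| "bfs (PNode ts # F) = length ts # bfs (F @ ts)"
  by pat_completeness auto
termination
  by (relation "Wellfounded.measure (\<lambda>F. size (forest_degs F))") auto

lemma mset_bfs: "mset (bfs F) = forest_degs F"
  by (induction F rule: bfs.induct) auto

text \<open>After a common first letter \<open>k\<close> the two queues again have equal length.
  Once they are known to agree, their last \<open>k\<close> entries are the children of the first
  root.\<close>

lemma bfs_injective: "length F = length G \<Longrightarrow> bfs F = bfs G \<Longrightarrow> F = G"
proof (induction F arbitrary: G rule: bfs.induct)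
  case (2 ts F)
  then obtain us H where G: "G = PNode us # H"
    by (cases G) (auto elim: subtrees.cases)
  show ?case
    using 2 unfolding G by (metis append_eq_append_conv bfs.simps(2) length_append list.inject length_Cons Suc_inject)
qed simp

lemma bfs_append: "bfs (F @ G) = map (length \<circ> subtrees) F @ bfs (G @ concat (map subtrees F))"
proof (induction F arbitrary: G)
  case (Cons t F)
  then show ?case by (cases t) simp
qed simp

lemma bfs_step: "bfs F = map (length \<circ> subtrees) F @ bfs (concat (map subtrees F))"
  using bfs_append[of F "[]"] by simp

text \<open>Reading a letter \<open>k\<close> removes one tree from the queue and adds
  \<open>k\<close>, so this is the net change of the queue length while \<open>xs\<close> is
  read.\<close>

definition excess :: "nat list \<Rightarrow> real" where
  "excess xs = (\<Sum>k\<leftarrow>xs. real k - 1)"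

lemma excess_simps [simp]:
  "excess [] = 0"
  "excess (k # xs) = real k - 1 + excess xs"
  "excess (xs @ ys) = excess xs + excess ys"
  by (simp_all add: excess_def)

lemma excess_subtrees:
  "real (length F) + excess (map (length \<circ> subtrees) F) = real (length (concat (map subtrees F)))"
  by (induction F) auto

text \<open>When all levels below \<open>h\<close> have been read, the queue is exactly level
  \<open>h\<close>. The left-hand side is the queue length after the prefix
  \<open>u\<close>.\<close>

lemma bfs_generation:
  "\<exists>u v. bfs F = u @ v \<and> real (length F) + excess u = real (length (generation h F))"
proof (induction h arbitrary: F)
  case 0
  show ?case by (intro exI[of _ "[]"] exI[of _ "bfs F"]) auto
next
  case (Suc h)
  obtain u v where uv: "bfs (concat (map subtrees F)) = u @ v"
      "real (length (concat (map subtrees F))) + excess u = real (length (generation (Suc h) F))"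
    using Suc[of "concat (map subtrees F)"] by auto
  then have "bfs F = (map (length \<circ> subtrees) F @ u) @ v"
    by (subst bfs_step) simp
  moreover have "real (length F) + excess (map (length \<circ> subtrees) F @ u)
      = real (length (generation (Suc h) F))"
    using uv(2) excess_subtrees[of F] by simp
  ultimately show ?case by blast
qed

text \<open>The queue cannot be empty while letters remain to be read.\<close>

lemma excess_bfs_prefix: "bfs F = u @ v \<Longrightarrow> v \<noteq> [] \<Longrightarrow> real (length F) + excess u \<ge> 1"
proof (induction F arbitrary: u rule: bfs.induct)
  case (2 ts F)
  show ?case
  proof (cases u)
    case (Cons k u')
    then have "real (length (F @ ts)) + excess u' \<ge> 1"
      using 2 by (intro "2.IH") auto
    then show ?thesis using Cons "2.prems" by auto
  qed simp
qed simp

lemma excess_bfs: "excess (bfs F) = - real (length F)"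
  by (induction F rule: bfs.induct) (auto simp: algebra_simps)

text \<open>Uniqueness in the cycle lemma: if both parts were nonempty, each would be a proper
  prefix of a tree word and have nonnegative excess, but the total is -1.\<close>

lemma bfs_rotation_unique:
  assumes "bfs [s] = u @ v" "bfs [t] = v @ u"
  shows "u = [] \<or> v = []"
proof (rule ccontr)
  assume *: "\<not> ?thesis"
  have "excess u \<ge> 0" "excess v \<ge> 0"
    using excess_bfs_prefix[OF assms(1)] excess_bfs_prefix[OF assms(2)] * by auto
  moreover have "excess u + excess v = -1"
    using excess_bfs[of "[s]"] assms(1) by simp
  ultimately show False by simp
qed

lemma rotate_bfs_injective:
  assumes eq: "rotate i (bfs [s]) = rotate j (bfs [t])"
    and i: "i < length (bfs [s])" and j: "j < length (bfs [t])"
  shows "s = t \<and> i = j"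
proof -
  \<comment> \<open>By symmetry let \<open>i \<le> j\<close>. Undoing the rotation by
    \<open>i\<close> shows one tree word to be a rotation of the other by
    \<open>j - i\<close>.\<close>
  have *: "s = t \<and> i = j"
    if eq: "rotate i (bfs [s]) = rotate j (bfs [t])" and ij: "i \<le> j"
      and i: "i < length (bfs [s])" and j: "j < length (bfs [t])" for i j s t
  proof -
    have len: "length (bfs [s]) = length (bfs [t])"
      using arg_cong[OF eq, of length] by simp
    let ?k = "j - i"
    have "rotate (length (bfs [s]) - i) (rotate i (bfs [s]))
        = rotate (length (bfs [s]) - i) (rotate i (rotate ?k (bfs [t])))"
      using eq ij by (simp add: rotate_rotate)
    then have "bfs [s] = rotate ?k (bfs [t])"
      using i len by (simp add: rotate_rotate) (metis add.commute add_diff_inverse_nat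
          le_add_diff_inverse less_or_eq_imp_le mod_add_self1 mod_self rotate_conv_mod rotate_id)
    then have s: "bfs [s] = drop ?k (bfs [t]) @ take ?k (bfs [t])"
      using j by (simp add: rotate_drop_take)
    have "take ?k (bfs [t]) = [] \<or> drop ?k (bfs [t]) = []"
      using bfs_rotation_unique[of t "take ?k (bfs [t])" "drop ?k (bfs [t])" s] s by simp
    then have "?k = 0" using j by auto
    then show ?thesis using s ij by (auto dest: bfs_injective[rotated])
  qed
  show ?thesis
    using *[OF eq _ i j] *[OF eq[symmetric] _ j i] by (cases "i \<le> j") auto
qed

section \<open>Counting forests\<close>

definition forests :: "nat \<Rightarrow> nat multiset \<Rightarrow> plane_tree list set" where
  "forests m D = {F. length F = m \<and> forest_degs F = D}"

lemma degs_subset_forest_degs: "t \<in> set F \<Longrightarrow> degs t \<subseteq># forest_degs F"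
  by (induction F) (auto intro: subset_mset.trans)

lemma finite_forests [simp]: "finite (forests m D)"
proof (rule finite_subset)
  show "forests m D \<subseteq> {F. set F \<subseteq> {t. tree_size t \<le> size D} \<and> length F = m}"
    by (auto simp: forests_def in_set_conv_nth) (metis degs_subset_forest_degs nth_mem size_degs size_mset_mono)
qed (intro finite_lists_length_eq finite_trees_size_le)

abbreviation num_perms :: "'a multiset \<Rightarrow> nat" where
  "num_perms D \<equiv> card (permutations_of_multiset D)"

lemma sum_mset_count: "(\<Sum>x\<in>#M. f x) = (\<Sum>x\<in>set_mset M. real (count M x) * f x)"
  for f :: "'a \<Rightarrow> real"
proof -
  \<comment> \<open>A fixed finite range \<open>A\<close> keeps the index set from changing during
    the induction on \<open>M\<close>.\<close>
  have "(\<Sum>x\<in>#M. f x) = (\<Sum>x\<in>A. real (count M x) * f x)"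
    if "finite A" "set_mset M \<subseteq> A" for A
    using that(2)
  proof (induction M)
    case (add y M)
    have "(\<Sum>x\<in>A. real (count (add_mset y M) x) * f x)
        = (\<Sum>x\<in>A. real (count M x) * f x + (if x = y then f x else 0))"
      by (intro sum.cong) (auto simp: algebra_simps)
    also have "\<dots> = (\<Sum>x\<in>A. real (count M x) * f x) + f y"
      using add.prems that(1) by (simp add: sum.distrib)
    finally show ?case using add by simp
  qed simp
  then show ?thesis by blast
qed

text \<open>The first letter of a uniform arrangement of \<open>D\<close> is a uniform entry of
  \<open>D\<close>: for \<open>k\<close> in \<open>D\<close>, the ratio of
  \<open>num_perms (D - {#k#})\<close> to \<open>num_perms D\<close> is the relative frequency of
  \<open>k\<close>.\<close>

lemma sum_num_perms_remove:
  fixes f :: "nat \<Rightarrow> real"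
  shows "(\<Sum>k\<in>set_mset D. real (num_perms (D - {#k#})) * f k)
       = real (num_perms D) / real (size D) * (\<Sum>k\<in>#D. f k)"
  unfolding sum_mset_count sum_distrib_left
  by (intro sum.cong) (auto simp: real_card_permutations_of_multiset_remove)

text \<open>Deleting the root of the first tree leaves its \<open>k\<close> subtrees at the front of
  the forest. Given \<open>k\<close> this can be undone, which yields a bijection.\<close>

lemma sum_forests_Suc:
  fixes f :: "plane_tree list \<Rightarrow> real"
  shows "(\<Sum>F\<in>forests (Suc m) D. f F)
       = (\<Sum>k\<in>set_mset D. \<Sum>G\<in>forests (k + m) (D - {#k#}). f (PNode (take k G) # drop k G))"
proof -
  let ?j = "\<lambda>G k. PNode (take k G) # drop k G"
  have "(\<Sum>k\<in>set_mset D. \<Sum>G\<in>forests (k + m) (D - {#k#}). f (?j G k))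
      = (\<Sum>(k, G)\<in>(SIGMA k:set_mset D. forests (k + m) (D - {#k#})). f (?j G k))"
    by (rule sum.Sigma) (auto intro: finite_forests)
  also have "\<dots> = (\<Sum>F\<in>forests (Suc m) D. f F)"
  proof (rule sum.reindex_bij_witness[where
        i = "\<lambda>F. (length (subtrees (hd F)), subtrees (hd F) @ tl F)" and j = "\<lambda>(k, G). ?j G k"], goal_cases)
    case (2 a)
    obtain k G where a: "a = (k, G)" by (cases a)
    with 2 have *: "k \<in># D" "length G = k + m" "forest_degs G = D - {#k#}"
      by (auto simp: forests_def)
    have "forest_degs (take k G @ drop k G) = D - {#k#}"
      using * by simp
    then have "forest_degs (take k G) + forest_degs (drop k G) = D - {#k#}"
      by (simp only: forest_degs_simps)
    with * show ?case by (simp add: a forests_def)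
  next
    case (3 F)
    then obtain ts G where "F = PNode ts # G"
      by (auto simp: forests_def length_Suc_conv) (metis plane_tree.exhaust)
    with 3 show ?case by (auto simp: forests_def)
  next
    case (4 F)
    then obtain ts G where "F = PNode ts # G"
      by (auto simp: forests_def length_Suc_conv) (metis plane_tree.exhaust)
    with 4 show ?case by (auto simp: forests_def)
  qed (auto simp: forests_def min_def)
  finally show ?thesis ..
qed

lemma forests_0: "forests 0 D = (if D = {#} then {[]} else {})"
  by (auto simp: forests_def)

text \<open>A form of the ballot theorem: the proportion is \<open>m / size D\<close>. The
  assumption is the identity \<open>size_forest_degs\<close>, and it is preserved when the first
  root is deleted.\<close>

lemma card_forests:
  assumes "size D = m + (\<Sum>k\<in>#D. k)"
  shows "real (size D) * real (card (forests m D)) = real m * real (num_perms D)"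
  using assms
proof (induction "size D" arbitrary: D m)
  case 0
  then show ?case by (simp add: forests_0)
next
  case (Suc n)
  then have D: "D \<noteq> {#}" by auto
  show ?case
  proof (cases m)
    case 0
    with D show ?thesis by (simp add: forests_0)
  next
    case (Suc m')
    have rec: "real (card (forests m D)) = (\<Sum>k\<in>set_mset D. real (card (forests (k + m') (D - {#k#}))))"
      using sum_forests_Suc[of "\<lambda>_. 1" m' D] Suc by simp
    have IH: "real n * real (card (forests (k + m') (D - {#k#})))
        = real (k + m') * real (num_perms (D - {#k#}))" if k: "k \<in># D" for k
    proof -
      have D': "D = add_mset k (D - {#k#})" using k by simp
      have "size D = Suc (size (D - {#k#}))" "(\<Sum>k\<in>#D. k) = k + (\<Sum>k\<in>#D - {#k#}. k)"
        by (subst D', simp)+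
      then show ?thesis
        using Suc.hyps(1)[of "D - {#k#}" "k + m'"] Suc.hyps(2) Suc.prems Suc by simp
    qed
    show ?thesis
    \<comment> \<open>The induction hypothesis carries a factor \<open>n\<close>, which can be
      cancelled only if it is nonzero.\<close>
    proof (cases "n = 0")
      case True
      then obtain k where "D = {#k#}"
        using Suc.hyps(2) by (metis size_1_singleton_mset One_nat_def)
      then show ?thesis
        using Suc.prems Suc rec by (simp add: forests_0)
    next
      case False
      have "real n * real (card (forests m D))
          = (\<Sum>k\<in>set_mset D. real (num_perms (D - {#k#})) * real (k + m'))"
        unfolding rec sum_distrib_left by (intro sum.cong refl) (simp only: IH mult.commute)
      also have "\<dots> = real (num_perms D) / real (size D) * (\<Sum>k\<in>#D. real (k + m'))"
        by (rule sum_num_perms_remove)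
      also have "(\<Sum>k\<in>#D. real (k + m')) = real (\<Sum>k\<in>#D. k) + real (size D) * real m'"
        by (induction D) (auto simp: algebra_simps)
      also have "\<dots> = real ((\<Sum>k\<in>#D. k) + size D * m')"
        by (simp del: of_nat_sum_mset)
      also have "(\<Sum>k\<in>#D. k) + size D * m' = n * m"
        using Suc.prems Suc Suc.hyps(2) by (simp add: algebra_simps)
      finally have "real n * (real (size D) * real (card (forests m D)))
          = real n * (real m * real (num_perms D))"
        using D by (simp add: field_simps)
      then show ?thesis
        using False by simp
    qed
  qed
qed

text \<open>Breadth-first words of distinct forests are distinct arrangements of
  \<open>D\<close>.\<close>

lemma card_forests_le: "card (forests m D) \<le> num_perms D"
proof (rule card_inj_on_le)
  show "inj_on bfs (forests m D)"
    by (auto simp: forests_def inj_on_def intro: bfs_injective)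
  show "bfs ` forests m D \<subseteq> permutations_of_multiset D"
    by (auto simp: forests_def mset_bfs permutations_of_multiset_def)
qed (rule finite_permutations_of_multiset)

definition trees :: "nat multiset \<Rightarrow> plane_tree set" where
  "trees D = {t. degs t = D}"

lemma forests_1: "forests 1 D = (\<lambda>t. [t]) ` trees D"
  by (auto simp: forests_def trees_def length_Suc_conv)

lemma card_trees:
  assumes "trees D \<noteq> {}"
  shows "real (size D) * real (card (trees D)) = real (num_perms D)"
proof -
  obtain t where "degs t = D" using assms by (auto simp: trees_def)
  then have "size D = 1 + (\<Sum>k\<in>#D. k)"
    using size_forest_degs[of "[t]"] by simp
  then have "real (size D) * real (card (forests 1 D)) = real (num_perms D)"
    using card_forests[of D 1] by simp
  also have "card (forests 1 D) = card (trees D)"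
    unfolding forests_1 by (rule card_image) (simp add: inj_on_def)
  finally show ?thesis .
qed

section \<open>Height\<close>

text \<open>
  The level sizes of the first tree only: by symmetry each tree of the forest contributes the same
  total. For \<open>m = 0\<close> the value is junk, since \<open>hd []\<close> is unspecified.
\<close>

definition level_total :: "nat \<Rightarrow> nat \<Rightarrow> nat multiset \<Rightarrow> real" where
  "level_total h m D = (\<Sum>F\<in>forests m D. real (length (generation h [hd F])))"

text \<open>Rotating the forest brings tree \<open>i\<close> to the front without changing the
  degree multiset.\<close>

lemma sum_level_nth:
  assumes "i < m"
  shows "(\<Sum>F\<in>forests m D. real (length (generation h [F ! i]))) = level_total h m D"
  unfolding level_total_def
proof (rule sum.reindex_bij_witness[where j = "rotate i" and i = "rotate (m - i)"])
  fix F assume F: "F \<in> forests m D"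
  then have [simp]: "length F = m" "F \<noteq> []" using assms by (auto simp: forests_def)
  have "rotate m F = F" by simp
  then show "rotate (m - i) (rotate i F) = F" "rotate i (rotate (m - i) F) = F"
    using assms by (simp_all add: rotate_rotate)
  show "rotate i F \<in> forests m D" "rotate (m - i) F \<in> forests m D"
    using F by (simp_all add: forests_def)
  have "hd (rotate i F) = F ! i"
    using assms by (simp add: hd_rotate_conv_nth)
  then show "real (length (generation h [hd (rotate i F)])) = real (length (generation h [F ! i]))"
    by simp
qed

text \<open>Level \<open>h + 1\<close> of the first tree is level \<open>h\<close> of the
  \<open>k\<close> trees that its root leaves at the front; by \<open>sum_level_nth\<close> these
  contribute equally.\<close>

lemma level_total_Suc:
  "level_total (Suc h) (Suc m) D
    = (\<Sum>k\<in>set_mset D. real k * level_total h (k + m) (D - {#k#}))"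
proof -
  have "(\<Sum>G\<in>forests (k + m) E. real (length (generation h (take k G))))
      = real k * level_total h (k + m) E" for k E
  proof -
    have "(\<Sum>G\<in>forests (k + m) E. real (length (generation h (take k G))))
        = (\<Sum>G\<in>forests (k + m) E. \<Sum>i<k. real (length (generation h [G ! i])))"
      by (intro sum.cong refl, subst length_generation)
         (auto simp: sum_list_nth forests_def)
    also have "\<dots> = (\<Sum>i<k. level_total h (k + m) E)"
      by (subst sum.swap, intro sum.cong refl sum_level_nth) auto
    finally show ?thesis by simp
  qed
  then show ?thesis
    unfolding level_total_def[of "Suc h"] by (simp add: sum_forests_Suc)
qed

section \<open>Elementary symmetric polynomials of the degrees, as coefficients of a generating
  polynomial\<close>

definition deg_poly :: "nat multiset \<Rightarrow> real poly" where
  "deg_poly D = (\<Prod>k\<in>#D. [:1, real k:])"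

lemma deg_poly_simps [simp]:
  "deg_poly {#} = 1"
  "deg_poly (add_mset k D) = [:1, real k:] * deg_poly D"
  by (simp_all add: deg_poly_def)

lemma coeff_deg_poly_nonneg: "coeff (deg_poly D) h \<ge> 0"
  by (induction D arbitrary: h) (auto simp: coeff_pCons split: nat.splits)

lemma pderiv_deg_poly: "pderiv (deg_poly D) = (\<Sum>k\<in>#D. smult (real k) (deg_poly (D - {#k#})))"
proof (induction D)
  case (add d D)
  have "(\<Sum>k\<in>#D. smult (real k) (deg_poly (add_mset d D - {#k#})))
      = (\<Sum>k\<in>#D. [:1, real d:] * smult (real k) (deg_poly (D - {#k#})))"
    by (intro arg_cong[of _ _ sum_mset] image_mset_cong) (simp add: add_mset_remove_trivial_If)
  also have "\<dots> = [:1, real d:] * pderiv (deg_poly D)"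
    by (simp add: add.IH sum_mset_distrib_left)
  finally show ?case
    by (simp add: pderiv_add pderiv_pCons pderiv_smult)
qed simp

text \<open>Both sides count the products of \<open>h + 1\<close> entries with one entry marked;
  formally, this compares coefficients in the derivative of the product.\<close>

lemma sum_coeff_deg_poly:
  "(\<Sum>k\<in>#D. real k * coeff (deg_poly (D - {#k#})) h) = real (Suc h) * coeff (deg_poly D) (Suc h)"
proof -
  have "coeff (\<Sum>k\<in>#D. f k) h = (\<Sum>k\<in>#D. coeff (f k) h)" for f :: "nat \<Rightarrow> real poly"
    by (induction D) auto
  then show ?thesis
    using arg_cong[OF pderiv_deg_poly[of D], of "\<lambda>p. coeff p h"] by (simp add: coeff_pderiv)
qed

text \<open>Each use of \<open>level_total_Suc\<close> removes one vertex of a path from the root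
  and contributes its degree. Averaging over the entries removed produces the elementary symmetric
  polynomial.\<close>

lemma level_total_le:
  assumes "m > 0"
  shows "level_total h m D * real (size D choose h) \<le> real (num_perms D) * coeff (deg_poly D) h"
  using assms
proof (induction h arbitrary: m D)
  case 0
  have "coeff (deg_poly D) 0 = 1"
    by (induction D) auto
  then show ?case
    using card_forests_le[of m D] by (simp add: level_total_def)
next
  case (Suc h)
  show ?case
  proof (cases "D = {#}")
    case True
    then show ?thesis
      by (simp add: coeff_deg_poly_nonneg)
  next
    case False
    then obtain m' n where m: "m = Suc m'" and n: "size D = Suc n"
      using Suc.prems by (metis gr0_implies_Suc not0_implies_Suc size_eq_0_iff_empty)
    have "level_total (Suc h) m D * real (n choose h)
        = (\<Sum>k\<in>set_mset D. real k * (level_total h (k + m') (D - {#k#}) * real (size (D - {#k#}) choose h)))"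
      unfolding m level_total_Suc sum_distrib_right
      by (intro sum.cong refl) (simp add: size_Diff_singleton n)
    also have "\<dots> \<le> (\<Sum>k\<in>set_mset D. real k * (real (num_perms (D - {#k#})) * coeff (deg_poly (D - {#k#})) h))"
    proof (rule sum_mono)
      fix k
      show "real k * (level_total h (k + m') (D - {#k#}) * real (size (D - {#k#}) choose h))
          \<le> real k * (real (num_perms (D - {#k#})) * coeff (deg_poly (D - {#k#})) h)"
        \<comment> \<open>For \<open>k = 0\<close> the forest may become empty, where the induction
          hypothesis says nothing, but then the factor \<open>k\<close> vanishes.\<close>
        by (cases "k = 0") (auto intro!: mult_left_mono Suc.IH)
    qed
    also have "\<dots> = (\<Sum>k\<in>set_mset D. real (num_perms (D - {#k#})) * (real k * coeff (deg_poly (D - {#k#})) h))"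
      by (simp add: mult_ac)
    also have "\<dots> = real (num_perms D) / real (Suc n) * (real (Suc h) * coeff (deg_poly D) (Suc h))"
      unfolding sum_num_perms_remove sum_coeff_deg_poly n ..
    finally have "real (Suc n) * real (n choose h) * level_total (Suc h) m D
        \<le> real (Suc h) * (real (num_perms D) * coeff (deg_poly D) (Suc h))"
      by (simp add: field_simps)
    also have "real (Suc n) * real (n choose h) = real (Suc h) * real (Suc n choose Suc h)"
      using Suc_times_binomial[of h n] by (metis of_nat_mult)
    finally show ?thesis
      by (simp add: n mult_ac del: of_nat_Suc binomial_Suc_Suc)
  qed
qed

lemma coeff_deg_poly_le:
  assumes "x \<ge> 0"
  shows "coeff (deg_poly D) h * x ^ h \<le> (\<Prod>k\<in>#D. 1 + real k * x)"
proof -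
  let ?p = "deg_poly D"
  have "coeff ?p h * x ^ h \<le> poly ?p x"
  proof (cases "h \<le> degree ?p")
    case True
    then show ?thesis unfolding poly_altdef
      using assms by (intro member_le_sum) (auto simp: coeff_deg_poly_nonneg)
  next
    case False
    then show ?thesis
      using assms by (auto simp: coeff_eq_0 poly_altdef coeff_deg_poly_nonneg intro!: sum_nonneg)
  qed
  also have "poly ?p x = (\<Prod>k\<in>#D. 1 + real k * x)"
  proof (induction D)
    case (add k D)
    have "poly (deg_poly (add_mset k D)) x = (1 + real k * x) * poly (deg_poly D) x"
      by (simp add: algebra_simps)
    then show ?case using add by simp
  qed simp
  finally show ?thesis .
qed

text \<open>The choice of \<open>x\<close> makes the \<open>h\<close>-th term of the binomial expansion the largest one.\<close>

lemma binomial_mode: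
  fixes h n :: nat
  assumes "0 < h" "h < n"
  defines "x \<equiv> real h / real (n - h)"
  shows "(1 + x) ^ n \<le> (real n + 1) * real (n choose h) * x ^ h"
proof -
  define f where "f k = real (n choose k) * x ^ k" for k
  have f0: "f k \<ge> 0" for k by (simp add: f_def x_def)
  have x: "x * (real n - real h) = real h"
    using assms by (simp add: x_def of_nat_diff)
  \<comment> \<open>The ratio of consecutive terms, with denominators cleared: \<open>f\<close>
    increases up to \<open>h\<close> and decreases from there on.\<close>
  have rec: "(real n - real h) * (real k + 1) * f (Suc k) = real h * (real n - real k) * f k"
    if "k < n" for k
  proof -
    have "Suc k * (n choose Suc k) = (n - k) * (n choose k)"
      by (simp only: binomial_absorption binomial_absorb_comp)
    then have *: "(real k + 1) * real (n choose Suc k) = (real n - real k) * real (n choose k)"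
      using that by (metis (no_types) add.commute of_nat_Suc of_nat_diff of_nat_mult order_less_imp_le)
    have "(real n - real h) * (real k + 1) * f (Suc k)
        = (x * (real n - real h)) * ((real k + 1) * real (n choose Suc k)) * x ^ k"
      by (simp add: f_def mult_ac)
    also have "\<dots> = real h * (real n - real k) * f k"
      unfolding x * by (simp add: f_def mult_ac)
    finally show ?thesis .
  qed
  have down: "f (Suc k) \<le> f k" if "h \<le> k" "k < n" for k
  proof -
    have "real h * (real n + 1) \<le> real n * (real k + 1)"
      using mult_right_mono[of "real h" "real k" "real n"] that assms(2)
      unfolding distrib_left by (intro add_mono) (auto simp: mult.commute)
    then have "real h * (real n - real k) * f k \<le> (real n - real h) * (real k + 1) * f k"
      by (intro mult_right_mono f0) (simp add: algebra_simps)
    then have "(real n - real h) * (real k + 1) * f (Suc k) \<le> (real n - real h) * (real k + 1) * f k"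
      using rec[OF that(2)] by simp
    then show ?thesis
      using assms(2) by (simp add: mult_le_cancel_left)
  qed
  have up: "f k \<le> f (Suc k)" if "Suc k \<le> h" for k
  proof -
    have "real n * (real k + 1) \<le> real n * real h"
      using that by (intro mult_left_mono) auto
    then have "(real n - real h) * (real k + 1) * f k \<le> real h * (real n - real k) * f k"
      by (intro mult_right_mono f0) (simp add: algebra_simps)
    also have "\<dots> = (real n - real h) * (real k + 1) * f (Suc k)"
      using rec[of k] that assms by simp
    finally show ?thesis
      using assms(2) by (simp add: mult_le_cancel_left)
  qed
  have "f k \<le> f h" if "k \<le> n" for k
  proof (cases "h \<le> k")
    case True
    then have "k \<le> n \<longrightarrow> f k \<le> f h"
      by (induction k rule: dec_induct) (auto intro: order_trans[OF down])
    with that show ?thesis by simp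
  next
    case False
    then have "k \<le> h" by simp
    then show ?thesis
      by (induction k rule: inc_induct) (auto intro: order_trans[OF up])
  qed
  then have "(\<Sum>k\<le>n. f k) \<le> (\<Sum>k\<le>n. f h)"
    by (intro sum_mono) auto
  moreover have "(1 + x) ^ n = (\<Sum>k\<le>n. f k)"
    using binomial_ring[of x 1 n] by (simp add: f_def add.commute)
  ultimately show ?thesis
    by (simp add: f_def algebra_simps)
qed

section \<open>Quadratic upper bounds for the logarithm\<close>

lemma ln_one_plus_le_quadratic:
  fixes x :: real
  assumes "-1 < x" "x \<le> 1"
  shows "ln (1 + x) \<le> x - x\<^sup>2 / 4"
proof -
  define g where "g x = x - x\<^sup>2 / 4 - ln (1 + x)" for x :: real
  \<comment> \<open>On the range considered this derivative has the sign of \<open>y\<close>, so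
    \<open>g\<close> is smallest at 0.\<close>
  have deriv: "(g has_real_derivative y * (1 - y) / (2 * (1 + y))) (at y)" if "-1 < y" for y
    unfolding g_def using that
    by (auto intro!: derivative_eq_intros simp: divide_simps) (simp add: algebra_simps)
  have "g x \<ge> g 0"
  proof (cases "x \<ge> 0")
    case True
    show ?thesis
    proof (rule DERIV_nonneg_imp_nondecreasing[OF True])
      fix y assume "0 \<le> y" "y \<le> x"
      then show "\<exists>d. (g has_real_derivative d) (at y) \<and> 0 \<le> d"
        using assms by (intro exI[of _ "y * (1 - y) / (2 * (1 + y))"] conjI deriv) auto
    qed
  next
    case False
    show ?thesis
    proof (rule DERIV_nonpos_imp_nonincreasing[of x 0])
      fix y assume "x \<le> y" "y \<le> 0"
      then show "\<exists>d. (g has_real_derivative d) (at y) \<and> d \<le> 0"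
        using assms by (intro exI[of _ "y * (1 - y) / (2 * (1 + y))"] conjI deriv)
          (auto intro!: divide_nonpos_pos mult_nonpos_nonneg)
    qed (use False in auto)
  qed
  then show ?thesis by (simp add: g_def)
qed

text \<open>Weakening the quadratic term by the factor \<open>B\<close> extends the bound from
  \<open>x \<le> 1\<close> to \<open>x \<le> B\<close>.\<close>

lemma one_plus_le_exp_quadratic:
  fixes x B :: real
  assumes "-1 < x" "x \<le> B" "1 \<le> B"
  shows "1 + x \<le> exp (x - x\<^sup>2 / (4 * B))"
proof -
  have "ln (1 + x) \<le> x - x\<^sup>2 / (4 * B)"
  proof (cases "x \<le> 1")
    case True
    have "x\<^sup>2 / (4 * B) \<le> x\<^sup>2 / 4"
      using assms by (intro divide_left_mono) auto
    with ln_one_plus_le_quadratic[OF assms(1) True] show ?thesis by simp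
  next
    case False
    \<comment> \<open>Here the quadratic term is at most \<open>x / 4\<close>, so the tangent bound
      at 1 together with \<open>ln 2 \<le> 3 / 4\<close> is enough.\<close>
    have "1 + x = 2 * ((1 + x) / 2)" by simp
    also have "ln \<dots> = ln 2 + ln ((1 + x) / 2)"
      using False by (subst ln_mult) auto
    also have "\<dots> \<le> 3 / 4 + ((1 + x) / 2 - 1)"
      using ln_one_plus_le_quadratic[of 1] False by (intro add_mono ln_le_minus_one) auto
    also have "\<dots> \<le> x - x / 4"
      using False by (simp add: field_simps)
    also have "\<dots> \<le> x - x\<^sup>2 / (4 * B)"
      using assms False by (simp add: field_simps power2_eq_square)
    finally show ?thesis by simp
  qed
  then have "exp (ln (1 + x)) \<le> exp (x - x\<^sup>2 / (4 * B))" by (rule iffD2[OF exp_le_cancel_iff])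
  then show ?thesis using assms by simp
qed

definition total_excess :: "nat multiset \<Rightarrow> real" where
  "total_excess D = (\<Sum>k\<in>#D. real k - 1)"

text \<open>This is sigma squared of the overview; the centre 1 differs from the mean degree of a
  tree by \<open>1 / n\<close>.\<close>

definition quad_var :: "nat multiset \<Rightarrow> real" where
  "quad_var D = (\<Sum>k\<in>#D. (real k - 1)\<^sup>2)"

lemma total_excess_simps [simp]:
  "total_excess {#} = 0"
  "total_excess (add_mset k D) = real k - 1 + total_excess D"
  by (simp_all add: total_excess_def)

lemma quad_var_simps [simp]:
  "quad_var {#} = 0"
  "quad_var (add_mset k D) = (real k - 1)\<^sup>2 + quad_var D"
  by (simp_all add: quad_var_def)

lemma quad_var_nonneg [simp]: "quad_var D \<ge> 0"
  by (induction D) auto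

lemma quad_var_ge_member: "k \<in># D \<Longrightarrow> (real k - 1)\<^sup>2 \<le> quad_var D"
  by (auto dest!: multi_member_split)

text \<open>Every integer \<open>a\<close> satisfies \<open>- a \<le> a^2\<close>. For trees, where
  the total excess is -1, this gives \<open>quad_var D \<ge> 1\<close>.\<close>

lemma quad_var_ge: "- total_excess D \<le> quad_var D"
proof (induction D)
  case (add k D)
  have "- (real k - 1) \<le> (real k - 1)\<^sup>2"
    by (cases k) (auto simp: power2_eq_square intro: order_trans[of _ 0])
  with add show ?case by simp
qed simp

lemma excess_mset: "excess xs = total_excess (mset xs)"
  by (induction xs) auto

lemma total_excess_degs: "total_excess (degs t) = -1"
  using excess_bfs[of "[t]"] by (simp add: excess_mset mset_bfs)

text \<open>First moment bound: a tree of height at least \<open>h\<close> has at least one vertex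
  on level \<open>h\<close>.\<close>

lemma card_high_le_level_total:
  "real (card {t \<in> trees D. h \<le> tree_height t}) \<le> level_total h 1 D"
proof -
  have fin: "finite (trees D)"
    using finite_forests[of 1 D] unfolding forests_1 by (rule finite_imageD) (auto simp: inj_on_def)
  have "real (card {t \<in> trees D. h \<le> tree_height t})
      = (\<Sum>t\<in>{t \<in> trees D. h \<le> tree_height t}. 1)"
    by simp
  also have "\<dots> \<le> (\<Sum>t\<in>{t \<in> trees D. h \<le> tree_height t}. real (length (generation h [t])))"
    by (intro sum_mono) (use generation_nonempty in \<open>auto simp: Suc_le_eq real_of_nat_ge_one_iff\<close>)
  also have "\<dots> \<le> (\<Sum>t\<in>trees D. real (length (generation h [t])))"
    by (intro sum_mono2 fin) auto
  also have "\<dots> = level_total h 1 D"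
    unfolding level_total_def forests_1 by (subst sum.reindex) (auto simp: inj_on_def)
  finally show ?thesis .
qed

lemma prod_degree_nonneg:
  fixes y :: real
  assumes "0 \<le> y" "y \<le> 1"
  shows "0 \<le> (\<Prod>k\<in>#E. 1 + y * (real k - 1))"
proof -
  have "0 \<le> 1 + y * (real k - 1)" for k
  proof -
    have "0 \<le> (1 - y) + y * real k" using assms by simp
    then show ?thesis by (simp add: algebra_simps)
  qed
  then show ?thesis by (induction E) auto
qed

text \<open>With \<open>x = h / (n - h)\<close> one has \<open>x / (1 + x) = y\<close>, so
  \<open>1 + k x\<close> factors as \<open>(1 + x) (1 + y (k - 1))\<close>. By
  \<open>binomial_mode\<close>, the powers of \<open>1 + x\<close> and \<open>x\<close> cost only
  \<open>n + 1\<close> times the binomial coefficient.\<close>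

lemma coeff_deg_poly_bound:
  assumes h: "0 < h" "h < size D"
  defines "y \<equiv> real h / real (size D)"
  shows "coeff (deg_poly D) h
    \<le> (real (size D) + 1) * real (size D choose h) * (\<Prod>k\<in>#D. 1 + y * (real k - 1))"
proof -
  define n where "n = size D"
  define x where "x = real h / real (n - h)"
  have x0: "x > 0" using h by (simp add: x_def n_def)
  have fact: "1 + real k * x = (1 + x) * (1 + y * (real k - 1))" for k
  proof -
    have "real n - real h \<noteq> 0" "real n \<noteq> 0" "x = real h / (real n - real h)" "y = real h / real n"
      using h by (auto simp: x_def y_def n_def of_nat_diff)
    then show ?thesis by (simp only:) (simp add: divide_simps, simp add: algebra_simps)
  qed
  have prod: "(\<Prod>k\<in>#E. 1 + real k * x) = (1 + x) ^ size E * (\<Prod>k\<in>#E. 1 + y * (real k - 1))" for E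
    unfolding fact by (induction E) auto
  have nonneg: "(\<Prod>k\<in>#E. 1 + y * (real k - 1)) \<ge> 0" for E
    using h by (intro prod_degree_nonneg) (auto simp: y_def divide_simps)
  have "coeff (deg_poly D) h * x ^ h \<le> (1 + x) ^ n * (\<Prod>k\<in>#D. 1 + y * (real k - 1))"
    using coeff_deg_poly_le[of x D h] x0 by (simp add: prod n_def)
  also have "\<dots> \<le> ((real n + 1) * real (n choose h) * x ^ h) * (\<Prod>k\<in>#D. 1 + y * (real k - 1))"
    using binomial_mode[of h n] h by (intro mult_right_mono nonneg) (auto simp: x_def n_def)
  finally have "coeff (deg_poly D) h * x ^ h
      \<le> ((real n + 1) * real (n choose h) * (\<Prod>k\<in>#D. 1 + y * (real k - 1))) * x ^ h"
    by (simp add: mult_ac)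
  then show ?thesis
    unfolding n_def by (rule mult_right_le_imp_le) (use x0 in simp)
qed

lemma prod_le_exp:
  assumes y: "0 < y" "y < 1" and D: "total_excess D = -1"
    and s: "1 \<le> y * sqrt (quad_var D)"
  shows "(\<Prod>k\<in>#D. 1 + y * (real k - 1)) \<le> exp (- (y * sqrt (quad_var D) / 4))"
proof -
  \<comment> \<open>With this \<open>B\<close> every \<open>y (k - 1)\<close> is at most
    \<open>B\<close>, and the quadratic terms add up to \<open>B / 4\<close>.\<close>
  define B where "B = y * sqrt (quad_var D)"
  have B: "B \<ge> 1" using s by (simp add: B_def)
  \<comment> \<open>The induction runs over submultisets, so that \<open>B\<close> keeps referring
    to all of \<open>D\<close>.\<close>
  have "(\<Prod>k\<in>#E. 1 + y * (real k - 1)) \<le> exp (y * total_excess E - y\<^sup>2 * quad_var E / (4 * B))"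
    if "E \<subseteq># D" for E
    using that
  proof (induction E)
    case (add k E)
    let ?z = "y * (real k - 1)"
    have "(real k - 1)\<^sup>2 \<le> quad_var D"
      by (rule quad_var_ge_member) (use add.prems in \<open>auto dest: mset_subset_eqD\<close>)
    then have "real k - 1 \<le> sqrt (quad_var D)"
      by (rule real_le_rsqrt)
    then have "?z \<le> B"
      using y by (simp add: B_def)
    moreover have z: "-1 < ?z"
      using y by (cases k) (auto intro: less_le_trans[of _ 0])
    ultimately have "1 + ?z \<le> exp (?z - ?z\<^sup>2 / (4 * B))"
      using B by (intro one_plus_le_exp_quadratic)
    moreover have "(\<Prod>k\<in>#E. 1 + y * (real k - 1)) \<le> exp (y * total_excess E - y\<^sup>2 * quad_var E / (4 * B))"
      using add.prems by (intro add.IH) (auto intro: subset_mset.trans[rotated])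
    ultimately have "(1 + ?z) * (\<Prod>k\<in>#E. 1 + y * (real k - 1))
        \<le> exp (?z - ?z\<^sup>2 / (4 * B)) * exp (y * total_excess E - y\<^sup>2 * quad_var E / (4 * B))"
      using z y by (intro mult_mono prod_degree_nonneg) auto
    also have "\<dots> = exp (y * total_excess (add_mset k E) - y\<^sup>2 * quad_var (add_mset k E) / (4 * B))"
      by (simp add: exp_add[symmetric] distrib_left add_divide_distrib power_mult_distrib)
    finally show ?case by simp
  qed simp
  from this[of D] have "(\<Prod>k\<in>#D. 1 + y * (real k - 1)) \<le> exp (- y - y\<^sup>2 * quad_var D / (4 * B))"
    by (simp add: D)
  also have "y\<^sup>2 * quad_var D = B\<^sup>2"
    by (simp add: B_def power_mult_distrib)
  also have "exp (- y - B\<^sup>2 / (4 * B)) \<le> exp (- (B / 4))"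
    using y B by (simp add: power2_eq_square)
  finally show ?thesis by (simp add: B_def)
qed

text \<open>The factor \<open>n\<close> comes from \<open>card_trees\<close> and
  \<open>n + 1\<close> from the binomial mode. Assumption \<open>s\<close> says that
  \<open>y * sqrt (quad_var D) \<ge> 1\<close>, as \<open>prod_le_exp\<close> requires.\<close>

lemma card_high:
  assumes "trees D \<noteq> {}" and h: "0 < h" "h < size D"
    and s: "real (size D) \<le> real h * sqrt (quad_var D)"
  shows "real (card {t \<in> trees D. h \<le> tree_height t})
    \<le> real (size D) * (real (size D) + 1) * exp (- (real h * sqrt (quad_var D) / (4 * real (size D))))
       * real (card (trees D))"
proof -
  let ?n = "size D"
  let ?y = "real h / real ?n"
  let ?P = "\<Prod>k\<in>#D. 1 + ?y * (real k - 1)"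
  let ?E = "exp (- (?y * sqrt (quad_var D) / 4))"
  have D: "total_excess D = -1"
    using assms(1) by (auto simp: trees_def total_excess_degs)
  have c: "real (?n choose h) > 0" using h by simp
  have "real (card {t \<in> trees D. h \<le> tree_height t}) * real (?n choose h)
      \<le> level_total h 1 D * real (?n choose h)"
    by (intro mult_right_mono card_high_le_level_total) auto
  also have "\<dots> \<le> real (num_perms D) * coeff (deg_poly D) h"
    by (intro level_total_le) auto
  also have "\<dots> \<le> real (num_perms D) * ((real ?n + 1) * real (?n choose h) * ?P)"
    using coeff_deg_poly_bound[OF h] by (intro mult_left_mono) auto
  also have "\<dots> \<le> real (num_perms D) * ((real ?n + 1) * real (?n choose h) * ?E)"
    using h s D by (intro mult_left_mono prod_le_exp) (auto simp: field_simps)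
  also have "\<dots> = (real ?n * (real ?n + 1) * ?E * real (card (trees D))) * real (?n choose h)"
    by (simp flip: card_trees[OF assms(1)] add: mult_ac)
  finally show ?thesis
    using c by (simp add: mult_ac)
qed

section \<open>Width\<close>

text \<open>A suffix holds the entries not yet read, so dropping the first letter leaves all shorter
  suffixes intact and permits induction on the multiset.\<close>

definition has_large_suffix :: "real \<Rightarrow> nat list \<Rightarrow> bool" where
  "has_large_suffix K xs \<longleftrightarrow> (\<exists>u v. xs = u @ v \<and> K \<le> \<bar>excess v\<bar>)"

lemma has_large_suffix_Cons:
  "has_large_suffix K (k # xs) \<longleftrightarrow> K \<le> \<bar>excess (k # xs)\<bar> \<or> has_large_suffix K xs"
  unfolding has_large_suffix_def Cons_eq_append_conv
  by (metis excess_simps(2))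

text \<open>
  Reading a uniform permutation from left to right, \<open>m\<^sup>2 + V\<close> is a supermartingale, where \<open>m\<close> and \<open>V\<close> are the
  sums of \<open>k - 1\<close> and of \<open>(k - 1)\<^sup>2\<close> over the entries \<open>k\<close> not yet read.
\<close>

lemma card_has_large_suffix:
  assumes "K > 0"
  shows "real (card {xs \<in> permutations_of_multiset D. has_large_suffix K xs}) * K\<^sup>2
    \<le> real (num_perms D) * ((total_excess D)\<^sup>2 + quad_var D)"
proof (induction D rule: multiset_remove_induct)
  case empty
  have none: "\<not> has_large_suffix K []"
    using assms by (simp add: has_large_suffix_def)
  have "{xs \<in> permutations_of_multiset {#}. has_large_suffix K xs} = {}"
    by (auto simp: none)
  then show ?case by (simp only:) simp
next
  case (remove D)
  let ?A = "\<lambda>D. {xs \<in> permutations_of_multiset D. has_large_suffix K xs}"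
  let ?m = "total_excess D" and ?V = "quad_var D"
  show ?case
  \<comment> \<open>Stopping rule: if the threshold is already reached, then \<open>K^2\<close> is
    below the current value of the supermartingale.\<close>
  proof (cases "K \<le> \<bar>?m\<bar>")
    case True
    have "K\<^sup>2 \<le> ?m\<^sup>2"
      using True assms by (simp add: abs_le_square_iff[symmetric])
    then have "K\<^sup>2 \<le> ?m\<^sup>2 + ?V"
      by (simp add: add_increasing2)
    moreover have "card (?A D) \<le> num_perms D"
      by (intro card_mono) auto
    ultimately show ?thesis by (intro mult_mono) auto
  next
    case False
    have "?A D \<subseteq> (\<Union>k\<in>set_mset D. (#) k ` ?A (D - {#k#}))"
    proof
      fix xs assume xs: "xs \<in> ?A D"
      then have "mset xs = D" by (simp add: permutations_of_multiset_def)
      with remove.hyps obtain k ys where k: "xs = k # ys" by (cases xs) auto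
      have "excess xs = ?m"
        using \<open>mset xs = D\<close> by (simp add: excess_mset)
      with xs False have "has_large_suffix K ys"
        unfolding k by (simp add: has_large_suffix_Cons)
      with \<open>mset xs = D\<close> k show "xs \<in> (\<Union>k\<in>set_mset D. (#) k ` ?A (D - {#k#}))"
        by (auto simp: permutations_of_multiset_def)
    qed
    then have "card (?A D) \<le> card (\<Union>k\<in>set_mset D. (#) k ` ?A (D - {#k#}))"
      by (intro card_mono) auto
    also have "\<dots> \<le> (\<Sum>k\<in>set_mset D. card ((#) k ` ?A (D - {#k#})))"
      by (rule card_UN_le) simp
    also have "\<dots> = (\<Sum>k\<in>set_mset D. card (?A (D - {#k#})))"
      by (simp add: card_image)
    finally have "real (card (?A D)) * K\<^sup>2 \<le> (\<Sum>k\<in>set_mset D. real (card (?A (D - {#k#})))) * K\<^sup>2"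
      by (intro mult_right_mono) (simp_all flip: of_nat_sum)
    also have "\<dots> \<le> (\<Sum>k\<in>set_mset D. real (num_perms (D - {#k#})) * (?m\<^sup>2 + ?V - 2 * ?m * (real k - 1)))"
      unfolding sum_distrib_right
    proof (rule sum_mono)
      fix k assume k: "k \<in> set_mset D"
      then obtain E where E: "D = add_mset k E" by (metis multi_member_split)
      \<comment> \<open>The two squares of \<open>k - 1\<close> cancel, leaving an expression linear
        in \<open>k\<close>.\<close>
      have "(total_excess (D - {#k#}))\<^sup>2 + quad_var (D - {#k#}) = ?m\<^sup>2 + ?V - 2 * ?m * (real k - 1)"
        unfolding E by (simp add: power2_eq_square algebra_simps)
      with remove.IH[OF k] show "real (card (?A (D - {#k#}))) * K\<^sup>2
          \<le> real (num_perms (D - {#k#})) * (?m\<^sup>2 + ?V - 2 * ?m * (real k - 1))"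
        by simp
    qed
    also have "\<dots> = real (num_perms D) / real (size D) * (\<Sum>k\<in>#D. ?m\<^sup>2 + ?V - 2 * ?m * (real k - 1))"
      by (rule sum_num_perms_remove)
    also have "(\<Sum>k\<in>#D. ?m\<^sup>2 + ?V - 2 * ?m * (real k - 1)) = real (size D) * (?m\<^sup>2 + ?V) - 2 * ?m\<^sup>2"
    proof -
      have "(\<Sum>k\<in>#E. c - 2 * d * (real k - 1)) = real (size E) * c - 2 * d * total_excess E" for c d E
        by (induction E) (auto simp: algebra_simps)
      then show ?thesis by (simp add: power2_eq_square)
    qed
    \<comment> \<open>The average drift \<open>- 2 m^2 / size D\<close> is nonpositive and is
      dropped.\<close>
    also have "real (num_perms D) / real (size D) * (real (size D) * (?m\<^sup>2 + ?V) - 2 * ?m\<^sup>2)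
        \<le> real (num_perms D) / real (size D) * (real (size D) * (?m\<^sup>2 + ?V))"
      by (intro mult_left_mono) auto
    also have "\<dots> = real (num_perms D) * (?m\<^sup>2 + ?V)"
      using remove.hyps by simp
    finally show ?thesis .
  qed
qed

text \<open>If the cut misses \<open>u\<close>, two suffix sums differ by \<open>excess u\<close>.
  If it splits \<open>u\<close> into \<open>a @ c\<close>, the suffixes \<open>a\<close> and
  \<open>v @ a\<close> recover both parts, using the total -1. Either way one suffix sum reaches
  \<open>K / 2\<close>.\<close>

lemma has_large_suffix_rotate:
  assumes w: "w = u @ v" and ex: "excess w = -1" and K: "K \<le> excess u" and i: "i < length w"
  shows "has_large_suffix (K / 2) (rotate i w)"
proof -
  have rot: "rotate i w = drop i (u @ v) @ take i (u @ v)"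
    using i by (simp add: rotate_drop_take w)
  show ?thesis
  proof (cases "i \<le> length u")
    case True
    define a c where "a = take i u" and "c = drop i u"
    have u: "u = a @ c" by (simp add: a_def c_def)
    have r: "rotate i w = c @ v @ a"
      using True by (simp add: rot a_def c_def)
    have "excess a + excess c \<ge> K" "excess v + excess a = - 1 - excess c"
      using K ex by (simp_all add: u w)
    then have "K / 2 \<le> \<bar>excess a\<bar> \<or> K / 2 \<le> \<bar>excess (v @ a)\<bar>"
      unfolding excess_simps by linarith
    moreover have "rotate i w = (c @ v) @ a" by (simp add: r)
    ultimately show ?thesis
      using r unfolding has_large_suffix_def by blast
  next
    case False
    define b c where "b = drop (i - length u) v" and "c = take (i - length u) v"
    have r: "rotate i w = b @ (u @ c)"
      using False by (simp add: rot b_def c_def)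
    have "K / 2 \<le> \<bar>excess c\<bar> \<or> K / 2 \<le> \<bar>excess (u @ c)\<bar>"
      using K unfolding excess_simps by linarith
    moreover have "rotate i w = (b @ u) @ c" by (simp add: r)
    ultimately show ?thesis
      using r unfolding has_large_suffix_def by blast
  qed
qed

text \<open>All \<open>n\<close> rotations of a wide tree's word are bad arrangements, and no
  arrangement arises twice. The factor 4 comes from halving \<open>K\<close>; \<open>K + 1\<close>
  appears because the queue starts with one tree.\<close>

lemma card_wide:
  assumes "trees D \<noteq> {}" "K > 0"
  shows "real (card {t \<in> trees D. K + 1 \<le> real (tree_width t)}) * K\<^sup>2
    \<le> 4 * (1 + quad_var D) * real (card (trees D))"
proof -
  let ?W = "{t \<in> trees D. K + 1 \<le> real (tree_width t)}"
  let ?n = "size D"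
  let ?A = "{xs \<in> permutations_of_multiset D. has_large_suffix (K / 2) xs}"
  let ?f = "\<lambda>(i, t). rotate i (bfs [t])"
  have mset: "mset (bfs [t]) = D" and len: "length (bfs [t]) = ?n" if "t \<in> trees D" for t
    using that mset_bfs[of "[t]"] by (auto simp: trees_def simp flip: size_mset)
  have D: "total_excess D = -1" "D \<noteq> {#}"
    using assms(1) by (auto simp: trees_def total_excess_degs)
  have inj: "inj_on ?f ({..<?n} \<times> ?W)"
    by (auto simp: inj_on_def len dest!: rotate_bfs_injective)
  have img: "?f ` ({..<?n} \<times> ?W) \<subseteq> ?A"
  proof clarsimp
    fix i t assume i: "i < ?n" and t: "t \<in> trees D" "K + 1 \<le> real (tree_width t)"
    obtain h where "tree_width t = length (generation h [t])"
      using tree_width_attained by blast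
    then obtain u v where "bfs [t] = u @ v" "1 + excess u = real (tree_width t)"
      using bfs_generation[of "[t]" h] by auto
    then have "has_large_suffix (K / 2) (rotate i (bfs [t]))"
      using i t len[OF t(1)] excess_bfs[of "[t]"] by (intro has_large_suffix_rotate) auto
    moreover have "mset (rotate i (bfs [t])) = D"
      using mset[OF t(1)] by (metis append_take_drop_id mset_append rotate_drop_take union_commute)
    ultimately show "rotate i (bfs [t]) \<in> permutations_of_multiset D \<and> has_large_suffix (K / 2) (rotate i (bfs [t]))"
      by (simp add: permutations_of_multiset_def)
  qed
  have "?n * card ?W = card (?f ` ({..<?n} \<times> ?W))"
    by (simp add: card_image[OF inj] card_cartesian_product)
  also have "\<dots> \<le> card ?A"
    by (rule card_mono[OF _ img]) auto
  finally have "real (?n * card ?W) * (K / 2)\<^sup>2 \<le> real (card ?A) * (K / 2)\<^sup>2"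
    by (intro mult_right_mono) (simp_all only: of_nat_le_iff zero_le_power2)
  also have "\<dots> \<le> real (num_perms D) * (1 + quad_var D)"
    using card_has_large_suffix[of "K / 2" D] assms(2) D by simp
  also have "\<dots> = real ?n * (real (card (trees D)) * (1 + quad_var D))"
    by (simp flip: card_trees[OF assms(1)])
  finally have "real ?n * (real (card ?W) * (K / 2)\<^sup>2) \<le> real ?n * (real (card (trees D)) * (1 + quad_var D))"
    by simp
  then have "real (card ?W) * (K / 2)\<^sup>2 \<le> real (card (trees D)) * (1 + quad_var D)"
    using D(2) by (simp add: mult_le_cancel_left nonempty_has_size)
  then show ?thesis
    by (simp add: power_divide field_simps)
qed

section \<open>The bound\<close>

lemma card_wide_high:
  assumes "trees D \<noteq> {}" and n: "size D = n" "n \<ge> 3" and s: "s \<ge> 230"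
  shows "real (card {t \<in> trees D. real (tree_width t) * real (tree_height t) > s * real n * ln (real n)})
    \<le> 23 / s * real (card (trees D))"
proof -
  let ?A = "{t \<in> trees D. real (tree_width t) * real (tree_height t) > s * real n * ln (real n)}"
  let ?C = "real (card (trees D))"
  define r where "r = sqrt (quad_var D)"
  define L where "L = ln (real n)"
  \<comment> \<open>With 12 the exponent in \<open>card_high\<close> is at least
    \<open>3 * L\<close>, so the exponential is at most \<open>1 / n^3\<close> and beats the
    prefactor \<open>n (n + 1)\<close>.\<close>
  define H where "H = 12 * real n * L / r"
  define h where "h = nat \<lceil>H\<rceil>"
  \<comment> \<open>A height below \<open>H\<close> forces the width above
    \<open>s * r / 12 = 2 * K\<close>, which is at least \<open>K + 1\<close> because
    \<open>K \<ge> 1\<close>.\<close>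
  define K where "K = s * r / 24"
  have size: "tree_size t = n" if "t \<in> trees D" for t
    using that n by (auto simp: trees_def size_degs)
  have fin: "finite (trees D)"
    by (rule finite_subset[OF _ finite_trees_of_size[of n]]) (auto simp: size)
  have V: "quad_var D \<ge> 1"
    using assms(1) quad_var_ge[of D] by (auto simp: trees_def total_excess_degs)
  then have r: "r \<ge> 1" "r\<^sup>2 = quad_var D" by (simp_all add: r_def)
  have "exp 1 \<le> real n" using exp_le n by linarith
  then have L: "L \<ge> 1"
    using n unfolding L_def by (subst ln_ge_iff) auto
  have "H > 0" using n L r by (simp add: H_def)
  then have h: "h > 0" "H \<le> real h" by (auto simp: h_def real_nat_ceiling_ge)
  have "K \<ge> 230 * 1 / 24"
    unfolding K_def using s r by (intro divide_right_mono mult_mono) auto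
  then have K: "K \<ge> 1" by simp
  show ?thesis
  proof (cases "?A = {}")
    case True
    then show ?thesis using s by (simp only: True) simp
  next
    case False
    then obtain t where t: "t \<in> trees D" "real (tree_width t) * real (tree_height t) > s * real n * L"
      by (auto simp: L_def)
    \<comment> \<open>One bad tree already forces \<open>s \<le> n\<close>, since width and height
      are at most \<open>n\<close>; this turns the height bound \<open>2 / n\<close> into
      \<open>2 / s\<close>.\<close>
    have "s * real n \<le> s * real n * L"
      using mult_left_mono[OF L, of "s * real n"] s by simp
    also have "\<dots> < real (tree_width t) * real (tree_height t)" by (rule t)
    also have "\<dots> \<le> real n * real n"
      using tree_width_le[of t] tree_height_less[of t] size[OF t(1)] by (intro mult_mono) auto
    finally have ns: "s \<le> real n" using n by simp
    have sub: "?A \<subseteq> {t \<in> trees D. h \<le> tree_height t} \<union> {t \<in> trees D. K + 1 \<le> real (tree_width t)}"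
    proof safe
      fix t assume t: "t \<in> trees D" "s * real n * ln (real n) < real (tree_width t) * real (tree_height t)"
        and "\<not> K + 1 \<le> real (tree_width t)"
      have False if "tree_height t < h"
      proof -
        have "int (tree_height t) < \<lceil>H\<rceil>" using that by (simp add: h_def zless_nat_eq_int_zless)
        then have "real (tree_height t) < H" by (simp add: less_ceiling_iff)
        then have "real (tree_width t) * real (tree_height t) \<le> real (tree_width t) * H"
          by (intro mult_left_mono) auto
        with t have "s * real n * L < real (tree_width t) * H" by (simp add: L_def)
        also have "\<dots> = (real n * L) * (12 * real (tree_width t) / r)" by (simp add: H_def)
        finally have "(real n * L) * s < (real n * L) * (12 * real (tree_width t) / r)"
          by (simp add: mult_ac)
        moreover have "real n * L > 0" using n L by simp
        ultimately have "s < 12 * real (tree_width t) / r"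
          by (simp only: mult_less_cancel_left_pos)
        then have "s * r < 12 * real (tree_width t)"
          using r by (simp add: pos_less_divide_eq)
        with K \<open>\<not> K + 1 \<le> real (tree_width t)\<close> show False
          unfolding K_def by simp
      qed
      then show "h \<le> tree_height t" by (meson not_less)
    qed
    have "card ?A \<le> card {t \<in> trees D. h \<le> tree_height t} + card {t \<in> trees D. K + 1 \<le> real (tree_width t)}"
      by (rule order_trans[OF card_mono[OF _ sub] card_Un_le]) (simp add: fin)
    then have "real (card ?A) \<le> real (card {t \<in> trees D. h \<le> tree_height t})
        + real (card {t \<in> trees D. K + 1 \<le> real (tree_width t)})"
      by (simp flip: of_nat_add)
    also have "\<dots> \<le> 2 / s * ?C + 21 / s * ?C"
    proof (rule add_mono)
      show "real (card {t \<in> trees D. h \<le> tree_height t}) \<le> 2 / s * ?C"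
      proof (cases "h < n")
        case True
        have Hr: "12 * real n * L \<le> real h * r"
          using h r by (simp add: H_def pos_divide_le_eq)
        have "real n * 1 \<le> (12 * real n) * L"
          using L by (intro mult_mono) auto
        also note Hr
        finally have "real n \<le> real h * r" by simp
        then have "real (card {t \<in> trees D. h \<le> tree_height t})
            \<le> real n * (real n + 1) * exp (- (real h * r / (4 * real n))) * ?C"
          using card_high[of D h] assms(1) h True n by (simp add: r_def)
        also have "\<dots> \<le> 2 / s * ?C"
        proof (rule mult_right_mono)
          have "3 * L \<le> real h * r / (4 * real n)"
            using Hr n by (simp add: field_simps)
          then have "exp (- (real h * r / (4 * real n))) \<le> exp (- (3 * L))" by simp
          also have "\<dots> = 1 / real n ^ 3"
          proof -
            have "exp (3 * L) = exp L ^ 3" by (simp flip: exp_of_nat_mult)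
            also have "exp L = real n" using n by (simp add: L_def)
            finally show ?thesis by (simp add: exp_minus divide_inverse)
          qed
          finally have "real n * (real n + 1) * exp (- (real h * r / (4 * real n)))
              \<le> real n * (real n + 1) * (1 / real n ^ 3)"
            by (intro mult_left_mono) auto
          also have "\<dots> \<le> 2 / real n"
            using n by (simp add: field_simps power3_eq_cube)
          also have "\<dots> \<le> 2 / s"
            using ns s by (intro divide_left_mono) auto
          finally show "real n * (real n + 1) * exp (- (real h * r / (4 * real n))) \<le> 2 / s" .
        qed simp
        finally show ?thesis .
      next
        case False
        then have "\<not> h \<le> tree_height t" if "t \<in> trees D" for t
          using tree_height_less[of t] size[OF that] by linarith
        then have "{t \<in> trees D. h \<le> tree_height t} = {}" by blast
        then show ?thesis using s by (simp only:) simp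
      qed
    next
      let ?w = "real (card {t \<in> trees D. K + 1 \<le> real (tree_width t)})"
      have "?w * K\<^sup>2 \<le> 4 * (1 + quad_var D) * ?C"
        using K by (intro card_wide assms(1)) auto
      also have "\<dots> \<le> 4 * (quad_var D + quad_var D) * ?C"
        using V by (intro mult_right_mono) auto
      \<comment> \<open>The constant is \<open>8 * 24^2\<close>. Since \<open>s \<ge> 230\<close>
        and \<open>4608 / 230 < 21\<close>, one factor \<open>s\<close> is traded for the constant
        21 below.\<close>
      finally have "(?w * s\<^sup>2) * quad_var D \<le> (4608 * ?C) * quad_var D"
        by (simp add: K_def r power_mult_distrib power_divide field_simps)
      then have "?w * s\<^sup>2 \<le> 4608 * ?C"
        using V by simp
      then have "?w * s * s \<le> 4608 * ?C" by (simp add: power2_eq_square mult_ac)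
      moreover have "?w * s * 230 \<le> ?w * s * s"
        using s by (intro mult_left_mono) auto
      ultimately have "?w * s \<le> 21 * ?C"
        using of_nat_0_le_iff[of "card (trees D)"] by linarith
      then show "?w \<le> 21 / s * ?C"
        using s by (simp add: pos_le_divide_eq)
    qed
    also have "\<dots> = 23 / s * ?C"
      by (simp add: field_simps)
    finally show ?thesis .
  qed
qed

text \<open>Trees are grouped by degree multiset; within a group the weight is a common factor, so
  the bound on proportions carries over to the weighted sums.\<close>

lemma sum_tree_weight_le:
  assumes "\<And>k. w k \<ge> 0"
    and *: "\<And>D. size D = n \<Longrightarrow> trees D \<noteq> {} \<Longrightarrow> real (card {t \<in> trees D. P t}) \<le> c * real (card (trees D))"
  shows "(\<Sum>t | tree_size t = n \<and> P t. tree_weight w t) \<le> c * partition_function w n"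
proof -
  let ?S = "{t. tree_size t = n}"
  let ?W = "\<lambda>D. \<Prod>k\<in>#D. w k"
  have W0: "?W D \<ge> 0" for D
    using assms(1) by (induction D) auto
  have group: "(\<Sum>t\<in>T. tree_weight w t) = (\<Sum>D\<in>degs ` ?S. ?W D * real (card {t \<in> T. degs t = D}))"
    if "T \<subseteq> ?S" for T
  proof -
    have "finite T" using that finite_trees_of_size by (rule finite_subset)
    then have "(\<Sum>t\<in>T. tree_weight w t) = (\<Sum>D\<in>degs ` ?S. \<Sum>t\<in>{t \<in> T. degs t = D}. tree_weight w t)"
      using that finite_trees_of_size[of n] by (intro sum.group[symmetric]) auto
    then show ?thesis by (simp add: tree_weight_degs mult.commute)
  qed
  have "(\<Sum>t | tree_size t = n \<and> P t. tree_weight w t)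
      = (\<Sum>D\<in>degs ` ?S. ?W D * real (card {t \<in> {t. tree_size t = n \<and> P t}. degs t = D}))"
    by (rule group) auto
  also have "\<dots> \<le> (\<Sum>D\<in>degs ` ?S. ?W D * (c * real (card {t \<in> ?S. degs t = D})))"
  proof (intro sum_mono mult_left_mono W0)
    fix D assume "D \<in> degs ` ?S"
    then have D: "size D = n" "trees D \<noteq> {}" by (auto simp: trees_def size_degs)
    have "{t \<in> {t. tree_size t = n \<and> P t}. degs t = D} = {t \<in> trees D. P t}" "{t \<in> ?S. degs t = D} = trees D"
      using D by (auto simp: trees_def simp flip: size_degs)
    then show "real (card {t \<in> {t. tree_size t = n \<and> P t}. degs t = D}) \<le> c * real (card {t \<in> ?S. degs t = D})"
      using *[OF D] by simp
  qed
  also have "\<dots> = c * partition_function w n"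
    unfolding partition_function_def by (subst group) (simp_all add: sum_distrib_left mult_ac)
  finally show ?thesis .
qed

lemma prob_simply_generated_tree:
  assumes "\<And>k. w k \<ge> 0" "partition_function w n > 0"
  shows "measure_pmf.prob (simply_generated_tree w n) {t. P t}
    = (\<Sum>t | tree_size t = n \<and> P t. tree_weight w t) / partition_function w n"
proof -
  let ?p = "simply_generated_tree w n"
  have pmf: "pmf ?p t = (if tree_size t = n then tree_weight w t / partition_function w n else 0)" for t
    by (rule pmf_simply_generated_tree[OF assms])
  have "measure_pmf.prob ?p {t. P t} = measure_pmf.prob ?p {t. tree_size t = n \<and> P t}"
  proof (rule measure_prob_cong_0)
  qed (auto simp: pmf)
  also have "\<dots> = (\<Sum>t | tree_size t = n \<and> P t. pmf ?p t)"
    by (rule measure_measure_pmf_finite)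
       (rule finite_subset[OF _ finite_trees_of_size[of n]], auto)
  finally show ?thesis
    by (simp add: pmf sum_divide_distrib)
qed

theorem theorem1p2:
  fixes w :: "nat \<Rightarrow> real" and n :: nat and s :: real
  assumes "\<And>k. w k \<ge> 0" and "w 0 > 0"
    and "n \<ge> 3" and "partition_function w n > 0"
    and "s > 0"
  shows "measure_pmf.prob (simply_generated_tree w n)
           {t. real (tree_width t) * real (tree_height t) > s * real n * ln (real n)}
         \<le> 230 * s powr (- 2 / 13)"
proof (cases "s \<ge> 230")
  case True
  have "measure_pmf.prob (simply_generated_tree w n)
      {t. real (tree_width t) * real (tree_height t) > s * real n * ln (real n)}
      \<le> 23 / s * partition_function w n / partition_function w n"
    unfolding prob_simply_generated_tree[OF assms(1,4)] using assms(4)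
    by (intro divide_right_mono sum_tree_weight_le assms(1) card_wide_high True assms(3)) auto
  also have "\<dots> = 23 * s powr (-1)"
    using assms(4,5) by (simp add: powr_minus_divide)
  \<comment> \<open>As \<open>s \<ge> 1\<close>, raising the exponent from -1 to -2/13 increases the
    power.\<close>
  also have "\<dots> \<le> 230 * s powr (- 2 / 13)"
    using True by (intro mult_mono powr_mono) auto
  finally show ?thesis .
next
  case False
  \<comment> \<open>The right-hand side is 1, written as a power so that first the exponent and then
    the base can be changed monotonically.\<close>
  have "measure_pmf.prob (simply_generated_tree w n)
      {t. real (tree_width t) * real (tree_height t) > s * real n * ln (real n)} \<le> 230 * 230 powr (-1)"
    by (simp add: powr_minus_divide)
  also have "\<dots> \<le> 230 * 230 powr (- 2 / 13)"
    by (intro mult_left_mono powr_mono) auto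
  also have "\<dots> \<le> 230 * s powr (- 2 / 13)"
    using False assms(5) by (intro mult_left_mono powr_mono2') auto
  finally show ?thesis .
qed

end
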